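(* Let $\mathcal{B}$ be an NGBA, $\mathcal{A}=\det(\mathcal{B})$, and let $d$ be a state of $\mathcal{A}$ (a generalised history tree). Let $\mathcal{S}^u,\mathcal{S}^o$ be the under- and over-approximating subset automata and $\mathcal{BP}^u,\mathcal{BP}^o$ the under- and over-approximating breakpoint automata of $\mathcal{B}$. Then $$\mathcal{L}(\mathcal{S}^u_{[d]})\subseteq\mathcal{L}(\mathcal{BP}^u_{\langle d\rangle})\subseteq\mathcal{L}(\mathcal{A}_d),\qquad \mathcal{L}(\mathcal{A}_d)\subseteq\mathcal{L}(\mathcal{BP}^o_{\langle d\rangle}),\qquad \mathcal{L}(\mathcal{A}_d)\subseteq\mathcal{L}(\mathcal{S}^o_{[d]}).$$
   Context: NGBA. $[1..k]=\{1,\dots,k\}$, $k\ge 1$; $j\oplus_k 1=j+1$ for $j<k$, $k\oplus_k 1=1$. An NGBA is $\mathcal{B}=(\Sigma,Q,I,T,(F_j)_{j\in[1..k]})$ with $\Sigma,Q$ finite, $\emptyset\ne I\subseteq Q$, $T\subseteq Q\times\Sigma\times Q$, $F_j\subseteq T$. For $R\subseteq Q$: $T(R,\sigma)=\{q':\exists q\in R,\ (q,\sigma,q')\in T\}$ and $F_j(R,\sigma)=\{q':\exists q\in R,\ (q,\sigma,q')\in F_j\}$. For a deterministic automaton $X$ (partial transition function), $X_x$ is $X$ with initial state $x$, and $\mathcal{L}$ denotes the set of $\omega$-words having an infinite accepting run. Generalised Büchi acceptance with sets $(F_j)$: infinitely many transitions in each $F_j$. Rabin acceptance with pairs $(A_i,R_i)$: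 for some $i$, infinitely many transitions in $A_i$ and finitely many in $R_i$. Determinisation $\det(\mathcal{B})$. An ordered tree is a finite nonempty set $\mathcal{T}\subseteq\mathbb{N}^*$ closed under predecessors and older siblings ($vn\in\mathcal T$, $i<n$ $\Rightarrow vi\in\mathcal T$); $\epsilon$ is the root. A generalised history tree (GHT) is $d=(\mathcal{T},l,h)$ with $\mathcal T$ an ordered tree, $l:\mathcal{T}\to 2^Q\setminus\{\emptyset\}$, $h:\mathcal T\to[1..k]$, where each non-root label is a proper subset of the predecessor's label, labels of distinct siblings are disjoint, and the union of the labels of the children of $v$ is strictly contained in $l(v)$. $\mathrm{rchd}(d):=l(\epsilon)$. $\mathcal{A}=\det(\mathcal{B})$ is the deterministic Rabin automaton whose states are the GHTs, with initial state $(\{\epsilon\},\epsilon\mapsto I,\epsilon\mapsto 1)$, and for each GHT $d$ and $\sigma$ with $T(l(\epsilon),\sigma)\neq\emptyset$ the $\sigma$-successor of $d$ is obtained as follows (otherwise undefined), with $Q_v:=l(v)$ the old labels: (i) for all nodes $v$ of $d$ set $l(v)=T(Q_v,\sigma)$; (ii) for each node $v$ of $d$ with $c$ children and $h(v)=i$ add a new child $vc$ with $l(vc)=F_i(Q_v,\sigma)$, $h(vc)=1$; (iii) for each node $v$ and each $q\in l(v)$, remove $q$ from the labels of all younger siblings of $v$ and of all their descendants; (iv) for each node $v$ whose label equals the union of the labels of its children, remove all descendants of $v$ and replace $h(v)$ by $h(v)\oplus_k1$; the transition is in $\mathsf A_v$ for all such $v$; (v) remove all nodes with empty label, giving $\mathcal{T}'$;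 (vi) rename each $v=n_1\dots n_j\in\mathcal T'$ to $\mathrm{rename}(v)=\|n_1\|\,\|n_1n_2\|\dots\|v\|$, where $\|w\|$ is the number of older siblings of $w$ still in $\mathcal{T}'$, carrying $l,h$ along; the transition is in $\mathsf R_v$ for each $v\notin\mathcal{T}\cap\mathcal{T}'$ ($\mathcal T$ the tree of $d$) and each $v\in\mathcal T'$ with $\mathrm{rename}(v)\ne v$. The Rabin pairs are $(\mathsf A_v,\mathsf R_v)$ for $v$ ranging over the nodes occurring in some ordered tree with $|Q|$ nodes. Subset automata. $\mathcal{S}^o,\mathcal{S}^u$ have states $2^Q$, initial state $I$, transitions $(R,\sigma,C)$ with $\emptyset\ne R\subseteq Q$, $C=T(R,\sigma)$, and generalised Büchi sets $F^o_i=\{(R,\sigma,C):\exists (q,q')\in R\times C,\ (q,\sigma,q')\in F_i\}$ and $F^u_i=\{(R,\sigma,C):\forall (q,q')\in R\times C,\ (q,\sigma,q')\in F_i\}$, $i\in[1..k]$. The state of the subset automata written $[d]$ is $\mathrm{rchd}(d)$. Breakpoint automata. $\mathcal{BP}^o,\mathcal{BP}^u$ have states $\{(R,j,C):C\subsetneq R\subseteq Q,\ j\in[1..k]\}$, initial state $(I,1,\emptyset)$. From $(R,j,C)$ on $\sigma$, with $R'=T(R,\sigma)\ne\emptyset$ and $C'=T(C,\sigma)\cup F_j(R,\sigma)$: if $C'=R'$ the successor is $(R',j\oplus_k1,\emptyset)$ and the transition is in $A_\epsilon$; if $C'\neq R'$ the successor is $(R',j,C')$, and the transition is in $R_0$ if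 $T(C,\sigma)=\emptyset$. No transition if $R'=\emptyset$. $\mathcal{BP}^u$ has the single Rabin pair $(A_\epsilon,\emptyset)$; $\mathcal{BP}^o$ has the Rabin pairs $(A_\epsilon,\emptyset)$ and $(T',R_0)$, $T'$ being the set of all transitions. For $d=(\mathcal T,l,h)$, $\langle d\rangle=(l(\epsilon),h(\epsilon),\bigcup_{i\in\mathcal T\cap\mathbb N}l(i))$. *)

theory Defs
  imports Main "HOL-Library.FuncSet"
begin

section \<open>Deterministic automata with transition-based acceptance\<close>

type_synonym ('s, 'a) transition = "'s \<times> 'a \<times> 's"

datatype ('s, 'a) acceptance =
    Gen_Buchi "('s, 'a) transition set set"
  | Rabin "(('s, 'a) transition set \<times> ('s, 'a) transition set) set"

text \<open>The argument is the sequence of transitions taken by a run.\<close>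

fun accepting :: "('s, 'a) acceptance \<Rightarrow> (nat \<Rightarrow> ('s, 'a) transition) \<Rightarrow> bool" where
  "accepting (Gen_Buchi \<F>) \<tau> \<longleftrightarrow> (\<forall>F \<in> \<F>. infinite {n. \<tau> n \<in> F})"
| "accepting (Rabin P) \<tau> \<longleftrightarrow>
     (\<exists>(A, R) \<in> P. infinite {n. \<tau> n \<in> A} \<and> finite {n. \<tau> n \<in> R})"

record ('s, 'a) da =
  da_alphabet :: "'a set"
  da_states :: "'s set"
  da_initial :: "'s"
  da_succ :: "'s \<Rightarrow> 'a \<Rightarrow> 's option"
  da_acceptance :: "('s, 'a) acceptance"

definition transitions_of ::
    "'s set \<Rightarrow> 'a set \<Rightarrow> ('s \<Rightarrow> 'a \<Rightarrow> 's option) \<Rightarrow> ('s, 'a) transition set" where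
  "transitions_of S \<Sigma> \<delta> = {(s, \<sigma>, s'). s \<in> S \<and> \<sigma> \<in> \<Sigma> \<and> \<delta> s \<sigma> = Some s'}"

definition da_run :: "('s, 'a) da \<Rightarrow> (nat \<Rightarrow> 'a) \<Rightarrow> (nat \<Rightarrow> 's) \<Rightarrow> bool" where
  "da_run X w r \<longleftrightarrow> r 0 = da_initial X \<and>
     (\<forall>n. (r n, w n, r (Suc n)) \<in> transitions_of (da_states X) (da_alphabet X) (da_succ X))"

definition lang :: "('s, 'a) da \<Rightarrow> (nat \<Rightarrow> 'a) set" where
  "lang X = {w. \<exists>r. da_run X w r \<and>
     accepting (da_acceptance X) (\<lambda>n. (r n, w n, r (Suc n)))}"

definition start_at :: "('s, 'a) da \<Rightarrow> 's \<Rightarrow> ('s, 'a) da" where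
  "start_at X x = X\<lparr>da_initial := x\<rparr>"


section \<open>Nondeterministic generalised Buchi automata\<close>

record ('q, 'a) ngba =
  alphabet :: "'a set"
  states :: "'q set"
  initials :: "'q set"
  trans :: "('q, 'a) transition set"
  acc_count :: nat
  acc_sets :: "nat \<Rightarrow> ('q, 'a) transition set"

text \<open>The number of acceptance sets is \<open>k = acc_count B\<close>; only the values of
  \<open>acc_sets B\<close> at the indices \<open>1, \<dots>, k\<close> are meaningful.\<close>

definition is_ngba :: "('q, 'a) ngba \<Rightarrow> bool" where
  "is_ngba B \<longleftrightarrow>
     finite (alphabet B) \<and> finite (states B) \<and>
     initials B \<noteq> {} \<and> initials B \<subseteq> states B \<and>
     trans B \<subseteq> states B \<times> alphabet B \<times> states B \<and>
     acc_count B \<ge> 1 \<and>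
     (\<forall>j \<in> {1..acc_count B}. acc_sets B j \<subseteq> trans B)"

definition post :: "('q, 'a) transition set \<Rightarrow> 'q set \<Rightarrow> 'a \<Rightarrow> 'q set" where
  "post D R \<sigma> = {q'. \<exists>q \<in> R. (q, \<sigma>, q') \<in> D}"

definition cyc_succ :: "nat \<Rightarrow> nat \<Rightarrow> nat" where
  "cyc_succ k j = (if j < k then j + 1 else 1)"


section \<open>Generalised history trees\<close>

text \<open>Nodes are finite sequences of naturals; \<open>v @ [n]\<close> is the \<open>n\<close>-th child of \<open>v\<close>,
  and a smaller \<open>n\<close> means an older sibling.\<close>

type_synonym node = "nat list"

definition ordered_tree :: "node set \<Rightarrow> bool" where
  "ordered_tree \<T> \<longleftrightarrow> finite \<T> \<and> \<T> \<noteq> {} \<and>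
     (\<forall>v n. v @ [n] \<in> \<T> \<longrightarrow> v \<in> \<T> \<and> (\<forall>i<n. v @ [i] \<in> \<T>))"

definition children :: "node set \<Rightarrow> node \<Rightarrow> node set" where
  "children \<T> v = {u \<in> \<T>. \<exists>n. u = v @ [n]}"

record 'q ght =
  tree :: "node set"
  label :: "node \<Rightarrow> 'q set"
  index :: "node \<Rightarrow> nat"

text \<open>Functions on the nodes are extensional, i.e. \<open>undefined\<close> outside the tree.\<close>

definition is_ght :: "('q, 'a) ngba \<Rightarrow> 'q ght \<Rightarrow> bool" where
  "is_ght B d \<longleftrightarrow>
     ordered_tree (tree d) \<and>
     label d \<in> tree d \<rightarrow>\<^sub>E (Pow (states B) - {{}}) \<and>
     index d \<in> tree d \<rightarrow>\<^sub>E {1..acc_count B} \<and>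
     (\<forall>v n. v @ [n] \<in> tree d \<longrightarrow> label d (v @ [n]) \<subset> label d v) \<and>
     (\<forall>v m n. v @ [m] \<in> tree d \<longrightarrow> v @ [n] \<in> tree d \<longrightarrow> m \<noteq> n \<longrightarrow>
        label d (v @ [m]) \<inter> label d (v @ [n]) = {}) \<and>
     (\<forall>v \<in> tree d. (\<Union>u \<in> children (tree d) v. label d u) \<subset> label d v)"

definition rchd :: "'q ght \<Rightarrow> 'q set" where
  "rchd d = label d []"


section \<open>Determinisation\<close>

text \<open>Update of labels and spawning of one new youngest child per node.  As the tree of
  a history tree contains all older siblings, the next free child position of \<open>v\<close> is its
  number of children.\<close>

definition spawn_tree :: "'q ght \<Rightarrow> node set" where
  "spawn_tree d = tree d \<union> {v @ [card (children (tree d) v)] |v. v \<in> tree d}"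

definition spawn_label :: "('q, 'a) ngba \<Rightarrow> 'q ght \<Rightarrow> 'a \<Rightarrow> node \<Rightarrow> 'q set" where
  "spawn_label B d \<sigma> u =
     (if u \<in> tree d then post (trans B) (label d u) \<sigma>
      else let v = butlast u in post (acc_sets B (index d v)) (label d v) \<sigma>)"

definition spawn_index :: "'q ght \<Rightarrow> node \<Rightarrow> nat" where
  "spawn_index d u = (if u \<in> tree d then index d u else 1)"

text \<open>Stealing: \<open>u = p @ n # w\<close> is \<open>p @ [n]\<close> or one of its descendants, and \<open>p @ [m]\<close> is an
  older sibling of \<open>p @ [n]\<close>.  All removals are performed simultaneously.\<close>

definition stolen_label :: "('q, 'a) ngba \<Rightarrow> 'q ght \<Rightarrow> 'a \<Rightarrow> node \<Rightarrow> 'q set" where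
  "stolen_label B d \<sigma> u =
     {q \<in> spawn_label B d \<sigma> u.
        \<not> (\<exists>p m n w. u = p @ n # w \<and> m < n \<and> p @ [m] \<in> spawn_tree d \<and>
             q \<in> spawn_label B d \<sigma> (p @ [m]))}"

definition accepting_nodes :: "('q, 'a) ngba \<Rightarrow> 'q ght \<Rightarrow> 'a \<Rightarrow> node set" where
  "accepting_nodes B d \<sigma> =
     {v \<in> spawn_tree d.
        stolen_label B d \<sigma> v = (\<Union>u \<in> children (spawn_tree d) v. stolen_label B d \<sigma> u)}"

definition accepting_index :: "('q, 'a) ngba \<Rightarrow> 'q ght \<Rightarrow> 'a \<Rightarrow> node \<Rightarrow> nat" where
  "accepting_index B d \<sigma> v =
     (if v \<in> accepting_nodes B d \<sigma> then cyc_succ (acc_count B) (spawn_index d v)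
      else spawn_index d v)"

text \<open>The nodes left after removing the proper descendants of accepting nodes and the
  nodes with empty label.\<close>

definition pruned_tree :: "('q, 'a) ngba \<Rightarrow> 'q ght \<Rightarrow> 'a \<Rightarrow> node set" where
  "pruned_tree B d \<sigma> =
     {u \<in> spawn_tree d.
        \<not> (\<exists>v w. u = v @ w \<and> w \<noteq> [] \<and> v \<in> accepting_nodes B d \<sigma>) \<and>
        stolen_label B d \<sigma> u \<noteq> {}}"

text \<open>Entry \<open>i\<close> (counted from 0) of a node becomes the number of remaining older siblings of
  its prefix of length \<open>i + 1\<close>.\<close>

definition rename :: "node set \<Rightarrow> node \<Rightarrow> node" where
  "rename \<T>' v =
     map (\<lambda>i. card {m. m < v ! i \<and> take i v @ [m] \<in> \<T>'}) [0..<length v]"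

definition renamed_ght :: "('q, 'a) ngba \<Rightarrow> 'q ght \<Rightarrow> 'a \<Rightarrow> 'q ght" where
  "renamed_ght B d \<sigma> =
     (let \<T>' = pruned_tree B d \<sigma>; \<T>'' = rename \<T>' ` \<T>'; old = inv_into \<T>' (rename \<T>')
      in \<lparr>tree = \<T>'',
          label = (\<lambda>v\<in>\<T>''. stolen_label B d \<sigma> (old v)),
          index = (\<lambda>v\<in>\<T>''. accepting_index B d \<sigma> (old v))\<rparr>)"

definition det_states :: "('q, 'a) ngba \<Rightarrow> 'q ght set" where
  "det_states B = {d. is_ght B d}"

definition det_succ :: "('q, 'a) ngba \<Rightarrow> 'q ght \<Rightarrow> 'a \<Rightarrow> 'q ght option" where
  "det_succ B d \<sigma> =
     (if post (trans B) (rchd d) \<sigma> \<noteq> {} then Some (renamed_ght B d \<sigma>) else None)"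

definition det_transitions :: "('q, 'a) ngba \<Rightarrow> ('q ght, 'a) transition set" where
  "det_transitions B = transitions_of (det_states B) (alphabet B) (det_succ B)"

definition det_A :: "('q, 'a) ngba \<Rightarrow> node \<Rightarrow> ('q ght, 'a) transition set" where
  "det_A B v = {(d, \<sigma>, d') \<in> det_transitions B. v \<in> accepting_nodes B d \<sigma>}"

definition det_R :: "('q, 'a) ngba \<Rightarrow> node \<Rightarrow> ('q ght, 'a) transition set" where
  "det_R B v = {(d, \<sigma>, d') \<in> det_transitions B.
     v \<notin> tree d \<inter> pruned_tree B d \<sigma> \<or>
     (v \<in> pruned_tree B d \<sigma> \<and> rename (pruned_tree B d \<sigma>) v \<noteq> v)}"

definition det :: "('q, 'a) ngba \<Rightarrow> ('q ght, 'a) da" where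
  "det B = \<lparr>
     da_alphabet = alphabet B,
     da_states = det_states B,
     da_initial = \<lparr>tree = {[]}, label = (\<lambda>v\<in>{[]}. initials B), index = (\<lambda>v\<in>{[]}. 1)\<rparr>,
     da_succ = det_succ B,
     da_acceptance = Rabin {(det_A B v, det_R B v) |v.
        \<exists>\<T>. ordered_tree \<T> \<and> card \<T> = card (states B) \<and> v \<in> \<T>}\<rparr>"


section \<open>Subset automata\<close>

definition subset_succ :: "('q, 'a) ngba \<Rightarrow> 'q set \<Rightarrow> 'a \<Rightarrow> 'q set option" where
  "subset_succ B R \<sigma> = (if R \<noteq> {} then Some (post (trans B) R \<sigma>) else None)"

definition subset_transitions :: "('q, 'a) ngba \<Rightarrow> ('q set, 'a) transition set" where
  "subset_transitions B = transitions_of (Pow (states B)) (alphabet B) (subset_succ B)"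

definition subset_Fo :: "('q, 'a) ngba \<Rightarrow> nat \<Rightarrow> ('q set, 'a) transition set" where
  "subset_Fo B i = {(R, \<sigma>, C) \<in> subset_transitions B.
     \<exists>(q, q') \<in> R \<times> C. (q, \<sigma>, q') \<in> acc_sets B i}"

definition subset_Fu :: "('q, 'a) ngba \<Rightarrow> nat \<Rightarrow> ('q set, 'a) transition set" where
  "subset_Fu B i = {(R, \<sigma>, C) \<in> subset_transitions B.
     \<forall>(q, q') \<in> R \<times> C. (q, \<sigma>, q') \<in> acc_sets B i}"

definition subset_o :: "('q, 'a) ngba \<Rightarrow> ('q set, 'a) da" where
  "subset_o B = \<lparr>
     da_alphabet = alphabet B,
     da_states = Pow (states B),
     da_initial = initials B,
     da_succ = subset_succ B,
     da_acceptance = Gen_Buchi (subset_Fo B ` {1..acc_count B})\<rparr>"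

definition subset_u :: "('q, 'a) ngba \<Rightarrow> ('q set, 'a) da" where
  "subset_u B = \<lparr>
     da_alphabet = alphabet B,
     da_states = Pow (states B),
     da_initial = initials B,
     da_succ = subset_succ B,
     da_acceptance = Gen_Buchi (subset_Fu B ` {1..acc_count B})\<rparr>"


section \<open>Breakpoint automata\<close>

type_synonym 'q bp_state = "'q set \<times> nat \<times> 'q set"

definition bp_states :: "('q, 'a) ngba \<Rightarrow> 'q bp_state set" where
  "bp_states B = {(R, j, C). C \<subset> R \<and> R \<subseteq> states B \<and> j \<in> {1..acc_count B}}"

definition bp_next :: "('q, 'a) ngba \<Rightarrow> 'q bp_state \<Rightarrow> 'a \<Rightarrow> 'q set" where
  "bp_next B = (\<lambda>(R, j, C) \<sigma>. post (trans B) C \<sigma> \<union> post (acc_sets B j) R \<sigma>)"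

definition bp_succ :: "('q, 'a) ngba \<Rightarrow> 'q bp_state \<Rightarrow> 'a \<Rightarrow> 'q bp_state option" where
  "bp_succ B = (\<lambda>(R, j, C) \<sigma>.
     let R' = post (trans B) R \<sigma>; C' = bp_next B (R, j, C) \<sigma>
     in if R' = {} then None
        else if C' = R' then Some (R', cyc_succ (acc_count B) j, {})
        else Some (R', j, C'))"

definition bp_transitions :: "('q, 'a) ngba \<Rightarrow> ('q bp_state, 'a) transition set" where
  "bp_transitions B = transitions_of (bp_states B) (alphabet B) (bp_succ B)"

definition bp_A :: "('q, 'a) ngba \<Rightarrow> ('q bp_state, 'a) transition set" where
  "bp_A B = {((R, j, C), \<sigma>, s') |R j C \<sigma> s'.
     ((R, j, C), \<sigma>, s') \<in> bp_transitions B \<and>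
     bp_next B (R, j, C) \<sigma> = post (trans B) R \<sigma>}"

definition bp_R :: "('q, 'a) ngba \<Rightarrow> ('q bp_state, 'a) transition set" where
  "bp_R B = {((R, j, C), \<sigma>, s') |R j C \<sigma> s'.
     ((R, j, C), \<sigma>, s') \<in> bp_transitions B \<and>
     bp_next B (R, j, C) \<sigma> \<noteq> post (trans B) R \<sigma> \<and>
     post (trans B) C \<sigma> = {}}"

definition breakpoint_u :: "('q, 'a) ngba \<Rightarrow> ('q bp_state, 'a) da" where
  "breakpoint_u B = \<lparr>
     da_alphabet = alphabet B,
     da_states = bp_states B,
     da_initial = (initials B, 1, {}),
     da_succ = bp_succ B,
     da_acceptance = Rabin {(bp_A B, {})}\<rparr>"

definition breakpoint_o :: "('q, 'a) ngba \<Rightarrow> ('q bp_state, 'a) da" where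
  "breakpoint_o B = \<lparr>
     da_alphabet = alphabet B,
     da_states = bp_states B,
     da_initial = (initials B, 1, {}),
     da_succ = bp_succ B,
     da_acceptance = Rabin {(bp_A B, {}), (bp_transitions B, bp_R B)}\<rparr>"

definition bp_of :: "'q ght \<Rightarrow> 'q bp_state" where
  "bp_of d = (label d [], index d [], \<Union>u \<in> children (tree d) []. label d u)"

end

theory Submission
  imports Defs "HOL-Library.Infinite_Set"
begin

text \<open>The map \<open>bp_of\<close> turns every transition of \<open>det B\<close> into the corresponding transition of the
  breakpoint automaton, because stealing among the children of the root does not change the union
  of their labels; the root accepts exactly when the breakpoint is reached, which gives the second
  inclusion and the third one for the root. The first inclusion holds because a transition of
  \<open>subset_Fu B j\<close> reaches the breakpoint at once when \<open>j\<close> is the current index. If a node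
  \<open>v \<noteq> []\<close> is eventually stable, its ancestor below the root survives, so the breakpoint set never dies out.
  Finally, an acceptance of a stable node \<open>v\<close> removes its children and advances its index to
  some \<open>i\<close>; the node can accept again only after a transition in the \<open>i\<close>-th acceptance set has
  repopulated a child, and the index runs through all of \<open>1, \<dots>, k\<close>.\<close>

section \<open>Renaming\<close>

lemma rename_Nil [simp]: "rename T [] = []"
  by (simp add: rename_def)

lemma length_rename [simp]: "length (rename T v) = length v"
  by (simp add: rename_def)

lemma rename_snoc: "rename T (v @ [n]) = rename T v @ [card {m. m < n \<and> v @ [m] \<in> T}]"
  by (simp add: rename_def nth_append)

text \<open>Induction from the last entry: the parents lie in \<open>T\<close> by
  \<open>closed\<close> and agree by induction, and below a common parent the number of older
  siblings in \<open>T\<close> strictly increases along the members of \<open>T\<close>.\<close>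

lemma inj_on_rename:
  assumes closed: "\<And>v n. v @ [n] \<in> T \<Longrightarrow> v \<in> T"
  shows "inj_on (rename T) T"
proof -
  have "u = v" if "u \<in> T" "v \<in> T" "rename T u = rename T v" for u v
    using that
  proof (induction u arbitrary: v rule: rev_induct)
    case Nil
    then show ?case by (metis length_rename length_0_conv)
  next
    case (snoc n u)
    have "length v = Suc (length u)"
      using snoc.prems(3) by (metis length_rename length_append_singleton)
    then obtain v' m where v: "v = v' @ [m]"
      by (metis length_Suc_conv_rev)
    have eq: "rename T u = rename T v'"
      "card {x. x < n \<and> u @ [x] \<in> T} = card {x. x < m \<and> v' @ [x] \<in> T}"
      using snoc.prems(3) unfolding v rename_snoc by auto
    have uv: "u = v'"
      using snoc.IH eq(1) closed snoc.prems(1,2) v by blast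
    have less: "card {x. x < a \<and> u @ [x] \<in> T} < card {x. x < b \<and> u @ [x] \<in> T}"
      if "a < b" "u @ [a] \<in> T" for a b
      by (rule psubset_card_mono) (use that in auto)
    have "u @ [n] \<in> T" "u @ [m] \<in> T" using snoc.prems(1,2) v uv by auto
    then have "n = m"
      using less[of n m] less[of m n] eq(2)[folded uv] by (cases n m rule: linorder_cases) auto
    then show ?case using uv v by simp
  qed
  then show ?thesis by (auto intro: inj_onI)
qed

text \<open>The count grows by at most one as \<open>n\<close> grows by one, so it passes through
  every smaller value, and it leaves a value \<open>i\<close> only at an element satisfying
  \<open>P\<close>.\<close>

lemma ex_card_less_eq:
  fixes i n :: nat
  assumes "i < card {m. m < n \<and> P m}"
  shows "\<exists>m<n. P m \<and> card {x. x < m \<and> P x} = i"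
  using assms
proof (induction n)
  case 0
  then show ?case by simp
next
  case (Suc n)
  show ?case
  proof (cases "i < card {m. m < n \<and> P m}")
    case True
    then show ?thesis using Suc.IH less_Suc_eq by blast
  next
    case False
    have "{m. m < Suc n \<and> P m} = (if P n then insert n {m. m < n \<and> P m} else {m. m < n \<and> P m})"
      by (auto simp: less_Suc_eq)
    then have "P n" "card {m. m < Suc n \<and> P m} = Suc (card {m. m < n \<and> P m})"
      using Suc.prems False by (auto split: if_splits)
    then show ?thesis
      using False Suc.prems by (intro exI[of _ n]) auto
  qed
qed

lemma rename_image_snocE:
  assumes "w @ [j] \<in> rename T ` T"
  obtains v n where "v @ [n] \<in> T" "rename T v = w" "rename T (v @ [n]) = w @ [j]"
    "j = card {m. m < n \<and> v @ [m] \<in> T}"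
proof -
  obtain u where u: "u \<in> T" "rename T u = w @ [j]" using assms by auto
  then have "length u = Suc (length w)"
    by (metis length_rename length_append_singleton)
  then obtain v n where "u = v @ [n]" by (metis length_Suc_conv_rev)
  then show thesis using that u by (auto simp: rename_snoc)
qed

text \<open>\<open>T\<close> may have gaps among siblings. The counting in \<open>rename\<close>
  closes them: by \<open>ex_card_less_eq\<close>, each position below a renamed child is the image
  of an older sibling that remains.\<close>

lemma ordered_tree_rename:
  assumes "finite T" "T \<noteq> {}" and closed: "\<And>v n. v @ [n] \<in> T \<Longrightarrow> v \<in> T"
  shows "ordered_tree (rename T ` T)"
proof -
  have "w \<in> rename T ` T \<and> (\<forall>i<j. w @ [i] \<in> rename T ` T)"
    if wj: "w @ [j] \<in> rename T ` T" for w j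
  proof (intro conjI allI impI)
    obtain v n where v: "v @ [n] \<in> T" "rename T v = w"
      and j: "j = card {m. m < n \<and> v @ [m] \<in> T}"
      using wj by (rule rename_image_snocE)
    show "w \<in> rename T ` T" using v closed by blast
    fix i assume "i < j"
    then obtain m where m: "v @ [m] \<in> T" "card {x. x < m \<and> v @ [x] \<in> T} = i"
      using ex_card_less_eq[of i n "\<lambda>m. v @ [m] \<in> T"] j by blast
    then have "rename T (v @ [m]) = w @ [i]" by (simp add: rename_snoc v)
    then show "w @ [i] \<in> rename T ` T" using m(1) by (intro image_eqI[of _ _ "v @ [m]"]) simp_all
  qed
  then show ?thesis unfolding ordered_tree_def using assms(1,2) by blast
qed

text \<open>A child of \<open>rename T v\<close> in the image comes from some child of a node
  \<open>u\<close> with the same image as \<open>v\<close>; injectivity gives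
  \<open>u = v\<close>.\<close>

lemma children_rename:
  assumes closed: "\<And>v n. v @ [n] \<in> T \<Longrightarrow> v \<in> T" and "v \<in> T"
  shows "children (rename T ` T) (rename T v) = rename T ` children T v"
proof
  show "children (rename T ` T) (rename T v) \<subseteq> rename T ` children T v"
  proof
    fix x assume "x \<in> children (rename T ` T) (rename T v)"
    then have "x \<in> rename T ` T" "\<exists>j. x = rename T v @ [j]"
      unfolding children_def by simp_all
    then obtain j where x: "x = rename T v @ [j]" "rename T v @ [j] \<in> rename T ` T"
      by metis
    from x(2) obtain u n where u: "u @ [n] \<in> T" "rename T u = rename T v"
      "rename T (u @ [n]) = rename T v @ [j]"
      by (rule rename_image_snocE)
    have "inj_on (rename T) T" using closed by (rule inj_on_rename)
    then have "u = v" using u(2) closed[OF u(1)] assms(2) by (rule inj_onD)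
    then have "u @ [n] \<in> children T v" using u by (simp add: children_def)
    then show "x \<in> rename T ` children T v"
      using u(3) x(1) by (intro image_eqI[of _ _ "u @ [n]"]) simp_all
  qed
  show "rename T ` children T v \<subseteq> children (rename T ` T) (rename T v)"
    unfolding children_def by (auto simp: rename_snoc image_iff)
qed

section \<open>One transition of the determinised automaton\<close>

lemma post_mono: "D \<subseteq> E \<Longrightarrow> R \<subseteq> S \<Longrightarrow> post D R \<sigma> \<subseteq> post E S \<sigma>"
  by (auto simp: post_def)

lemma post_empty [simp]: "post D {} \<sigma> = {}"
  by (simp add: post_def)

lemma post_UN: "post D (\<Union>u\<in>A. f u) \<sigma> = (\<Union>u\<in>A. post D (f u) \<sigma>)"
  by (auto simp: post_def)

lemma post_subset_states: "is_ngba B \<Longrightarrow> post (trans B) R \<sigma> \<subseteq> states B"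
  by (auto simp: post_def is_ngba_def)

lemma cyc_succ_in: "1 \<le> k \<Longrightarrow> j \<in> {1..k} \<Longrightarrow> cyc_succ k j \<in> {1..k}"
  by (auto simp: cyc_succ_def)

lemma ordered_tree_prefix: "ordered_tree T \<Longrightarrow> v @ w \<in> T \<Longrightarrow> v \<in> T"
proof (induction w rule: rev_induct)
  case (snoc n w)
  have "(v @ w) @ [n] \<in> T" using snoc.prems(2) by simp
  then have "v @ w \<in> T" using snoc.prems(1) unfolding ordered_tree_def by blast
  then show ?case by (rule snoc.IH[OF snoc.prems(1)])
qed simp

lemma ght_root: "is_ght B d \<Longrightarrow> [] \<in> tree d"
  by (metis append_Nil ex_in_conv is_ght_def ordered_tree_def ordered_tree_prefix)

lemma ght_label_child: "is_ght B d \<Longrightarrow> v @ [n] \<in> tree d \<Longrightarrow> label d (v @ [n]) \<subset> label d v"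
  by (simp add: is_ght_def)

lemma ght_label_prefix: "is_ght B d \<Longrightarrow> v @ w \<in> tree d \<Longrightarrow> label d (v @ w) \<subseteq> label d v"
proof (induction w rule: rev_induct)
  case (snoc n w)
  have vw: "(v @ w) @ [n] \<in> tree d" using snoc.prems(2) by simp
  have "ordered_tree (tree d)" using snoc.prems(1) by (simp add: is_ght_def)
  then have "v @ w \<in> tree d" using vw by (rule ordered_tree_prefix)
  then have "label d (v @ w) \<subseteq> label d v" by (rule snoc.IH[OF snoc.prems(1)])
  then show ?case using ght_label_child[OF snoc.prems(1) vw] by simp
qed simp

text \<open>One enabled transition from a history tree. The later proofs about runs interpret it at
  single positions of a run.\<close>

locale ght_step =
  fixes B :: "('q, 'a) ngba" and d :: "'q ght" and \<sigma> :: 'a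
  assumes ngba: "is_ngba B" and ght: "is_ght B d"
    and enabled: "post (trans B) (rchd d) \<sigma> \<noteq> {}"
begin

abbreviation "T \<equiv> tree d"
abbreviation "S \<equiv> spawn_tree d"
abbreviation "P \<equiv> pruned_tree B d \<sigma>"
abbreviation "sl \<equiv> spawn_label B d \<sigma>"
abbreviation "st \<equiv> stolen_label B d \<sigma>"
abbreviation "d' \<equiv> renamed_ght B d \<sigma>"

lemma ordered: "ordered_tree T"
  using ght by (simp add: is_ght_def)

text \<open>Pigeonhole: if that position were occupied, closure under older siblings would give
  \<open>v\<close> one child more than it has.\<close>

lemma new_child_notin: "v @ [card (children T v)] \<notin> T"
proof
  let ?c = "card (children T v)"
  assume new: "v @ [?c] \<in> T"
  have "v @ [i] \<in> T" if "i \<le> ?c" for i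
    using ordered new that unfolding ordered_tree_def by (metis le_neq_implies_less)
  then have "(\<lambda>i. v @ [i]) ` {..?c} \<subseteq> children T v"
    by (auto simp: children_def)
  moreover have "finite (children T v)"
    using ordered by (auto simp: children_def ordered_tree_def)
  ultimately have "card ((\<lambda>i. v @ [i]) ` {..?c}) \<le> ?c" by (rule card_mono[rotated])
  then show False by (simp add: card_image inj_on_def)
qed

lemma index_in: "v \<in> T \<Longrightarrow> index d v \<in> {1..acc_count B}"
  using ght by (auto simp: is_ght_def)

lemma acc_subset_trans: "v \<in> T \<Longrightarrow> acc_sets B (index d v) \<subseteq> trans B"
  using ngba index_in by (auto simp: is_ngba_def)

section \<open>Labels after spawning and stealing\<close>

lemma finite_spawn: "finite S"
proof -
  have "S = T \<union> (\<lambda>v. v @ [card (children T v)]) ` T" by (auto simp: spawn_tree_def)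
  then show ?thesis using ordered by (simp add: ordered_tree_def)
qed

lemma spawn_parent: "v @ [n] \<in> S \<Longrightarrow> v \<in> T"
  using ordered by (auto simp: spawn_tree_def ordered_tree_def)

lemma tree_subset_spawn: "T \<subseteq> S"
  by (auto simp: spawn_tree_def)

lemma children_spawn:
  "v \<in> T \<Longrightarrow> children S v = insert (v @ [card (children T v)]) (children T v)"
  by (auto simp: children_def spawn_tree_def)

lemma spawn_label_old: "v \<in> T \<Longrightarrow> sl v = post (trans B) (label d v) \<sigma>"
  by (simp add: spawn_label_def)

lemma spawn_label_new:
  "sl (v @ [card (children T v)]) = post (acc_sets B (index d v)) (label d v) \<sigma>"
  by (simp add: spawn_label_def new_child_notin)

lemma spawn_label_child: "v @ [n] \<in> S \<Longrightarrow> sl (v @ [n]) \<subseteq> sl v"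
proof -
  assume vn: "v @ [n] \<in> S"
  have v: "v \<in> T" using vn by (rule spawn_parent)
  show ?thesis
  proof (cases "v @ [n] \<in> T")
    case True
    then have "label d (v @ [n]) \<subseteq> label d v" using ght ght_label_prefix by blast
    then show ?thesis using True v by (simp add: spawn_label_old post_mono)
  next
    case False
    then show ?thesis
      using v acc_subset_trans[OF v] by (simp add: spawn_label_def post_mono)
  qed
qed

lemma stolen_subset: "st v \<subseteq> sl v"
  by (auto simp: stolen_label_def)

text \<open>An older sibling of \<open>v\<close> or of an ancestor of \<open>v\<close> that takes a
  state from \<open>v\<close> takes it from all descendants of \<open>v\<close> as well.\<close>

lemma stolen_child: "v @ [n] \<in> S \<Longrightarrow> st (v @ [n]) \<subseteq> st v"
  using spawn_label_child by (fastforce simp: stolen_label_def)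

lemma stolen_disjoint:
  assumes "v @ [m] \<in> S" "v @ [n] \<in> S" "m \<noteq> n"
  shows "st (v @ [m]) \<inter> st (v @ [n]) = {}"
proof -
  have "st (v @ [a]) \<inter> st (v @ [b]) = {}" if "v @ [a] \<in> S" "a < b" for a b
    using that by (fastforce simp: stolen_label_def)
  then show ?thesis using assms by (metis Int_commute linorder_neqE_nat)
qed

lemma stolen_root: "st [] = post (trans B) (label d []) \<sigma>"
  using ght_root[OF ght] by (simp add: stolen_label_def spawn_label_old)

text \<open>The root has no siblings, so a child of the root loses states only to its own older
  siblings; each state therefore stays in the oldest child that holds it. The old children
  contribute the \<open>trans B\<close> part of \<open>bp_next\<close>, the spawned child the
  \<open>acc_sets\<close> part.\<close>

lemma stolen_children_root:
  "(\<Union>u\<in>children S []. st u) = bp_next B (bp_of d) \<sigma>"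
proof -
  have root: "[] \<in> T" using ght by (rule ght_root)
  have "(\<Union>u\<in>children S []. st u) = (\<Union>u\<in>children S []. sl u)"
  proof
    show "(\<Union>u\<in>children S []. sl u) \<subseteq> (\<Union>u\<in>children S []. st u)"
    proof
      fix q assume "q \<in> (\<Union>u\<in>children S []. sl u)"
      then obtain n where n: "[n] \<in> S \<and> q \<in> sl [n]" by (auto simp: children_def)
      \<comment> \<open>The oldest child of the root holding \<open>q\<close>, from which nobody can
        steal it.\<close>
      define m where "m = (LEAST n. [n] \<in> S \<and> q \<in> sl [n])"
      have m: "[m] \<in> S \<and> q \<in> sl [m]" unfolding m_def using n by (rule LeastI)
      have "\<not> ([i] \<in> S \<and> q \<in> sl [i])" if "i < m" for i
        using that unfolding m_def by (rule not_less_Least)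
      then have "q \<in> st [m]"
        using m by (auto simp: stolen_label_def Cons_eq_append_conv)
      then show "q \<in> (\<Union>u\<in>children S []. st u)" using m by (auto simp: children_def)
    qed
  qed (use stolen_subset in blast)
  also have "\<dots> = (\<Union>u\<in>children T []. sl u) \<union> sl ([] @ [card (children T [])])"
    using children_spawn[OF root] by auto
  also have "\<dots> = (\<Union>u\<in>children T []. post (trans B) (label d u) \<sigma>)
      \<union> post (acc_sets B (index d [])) (label d []) \<sigma>"
    unfolding spawn_label_new by (auto simp: spawn_label_old children_def)
  finally show ?thesis by (simp add: bp_next_def bp_of_def post_UN)
qed

lemma root_accepting_iff:
  "[] \<in> accepting_nodes B d \<sigma> \<longleftrightarrow> bp_next B (bp_of d) \<sigma> = post (trans B) (label d []) \<sigma>"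
  using tree_subset_spawn ght_root[OF ght]
  by (auto simp: accepting_nodes_def stolen_children_root stolen_root)

section \<open>The pruned tree\<close>

lemma pruned_subset: "P \<subseteq> S"
  by (auto simp: pruned_tree_def)

lemma pruned_nonempty: "v \<in> P \<Longrightarrow> st v \<noteq> {}"
  by (simp add: pruned_tree_def)

text \<open>The label of \<open>v\<close> contains the nonempty label of its child, and an accepting
  proper ancestor of \<open>v\<close> would have removed the child too.\<close>

lemma pruned_closed: "v @ [n] \<in> P \<Longrightarrow> v \<in> P"
proof -
  assume vn: "v @ [n] \<in> P"
  then have "v \<in> S" "st v \<noteq> {}"
    using spawn_parent[of v n] tree_subset_spawn stolen_child[of v n]
    by (auto simp: pruned_tree_def)
  moreover have "\<not> (\<exists>x w. v = x @ w \<and> w \<noteq> [] \<and> x \<in> accepting_nodes B d \<sigma>)"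
    using vn by (fastforce simp: pruned_tree_def)
  ultimately show ?thesis by (simp add: pruned_tree_def)
qed

lemma pruned_prefix: "v @ w \<in> P \<Longrightarrow> v \<in> P"
proof (induction w rule: rev_induct)
  case (snoc n w)
  then show ?case using pruned_closed[of "v @ w" n] by simp
qed simp

lemma root_pruned: "[] \<in> P"
  using tree_subset_spawn ght_root[OF ght] enabled
  by (auto simp: pruned_tree_def stolen_root rchd_def)

lemma finite_pruned: "finite P"
  using finite_spawn pruned_subset by (rule rev_finite_subset)

section \<open>The successor history tree and its breakpoint state\<close>

lemma tree_renamed: "tree d' = rename P ` P"
  by (simp add: renamed_ght_def Let_def)

lemma inj_rename: "inj_on (rename P) P"
  by (rule inj_on_rename) (rule pruned_closed)

lemma label_renamed: "v \<in> P \<Longrightarrow> label d' (rename P v) = st v"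
  by (simp add: renamed_ght_def Let_def inv_into_f_f[OF inj_rename])

lemma index_renamed: "v \<in> P \<Longrightarrow> index d' (rename P v) = accepting_index B d \<sigma> v"
  by (simp add: renamed_ght_def Let_def inv_into_f_f[OF inj_rename])

lemma children_renamed: "v \<in> P \<Longrightarrow> children (tree d') (rename P v) = rename P ` children P v"
  unfolding tree_renamed by (rule children_rename) (rule pruned_closed)

lemma label_children_renamed:
  assumes "v \<in> P"
  shows "(\<Union>u\<in>children (tree d') (rename P v). label d' u) = (\<Union>u\<in>children P v. st u)"
  using assms by (simp add: children_renamed) (auto simp: label_renamed children_def)

lemma accepting_children_pruned: "v \<in> accepting_nodes B d \<sigma> \<Longrightarrow> children P v = {}"
  by (auto simp: children_def pruned_tree_def)

lemma stolen_children_subset: "(\<Union>u\<in>children S v. st u) \<subseteq> st v"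
  using stolen_child by (fastforce simp: children_def)

text \<open>An accepting node keeps a nonempty label but no children. At any other node the union
  over the spawned children already differs from the label, and pruning only shrinks that
  union.\<close>

lemma stolen_children_pruned_psubset:
  assumes v: "v \<in> P"
  shows "(\<Union>u\<in>children P v. st u) \<subset> st v"
proof (cases "v \<in> accepting_nodes B d \<sigma>")
  case True
  then have "children P v = {}" by (rule accepting_children_pruned)
  moreover have "st v \<noteq> {}" using v by (rule pruned_nonempty)
  ultimately show ?thesis by auto
next
  case False
  have "(\<Union>u\<in>children S v. st u) \<subset> st v"
    using False v pruned_subset stolen_children_subset by (fastforce simp: accepting_nodes_def)
  moreover have "children P v \<subseteq> children S v"
    using pruned_subset by (auto simp: children_def)
  ultimately show ?thesis by blast
qed

lemma accepting_index_in: "v \<in> P \<Longrightarrow> accepting_index B d \<sigma> v \<in> {1..acc_count B}"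
proof -
  have k: "1 \<le> acc_count B" using ngba by (simp add: is_ngba_def)
  then have "spawn_index d v \<in> {1..acc_count B}"
    using index_in by (auto simp: spawn_index_def)
  then show ?thesis using cyc_succ_in[OF k] by (auto simp: accepting_index_def)
qed

lemma stolen_states: "v \<in> S \<Longrightarrow> st v \<subseteq> states B"
proof -
  assume "v \<in> S"
  then have "sl v \<subseteq> states B"
  proof (cases "v \<in> T")
    case True
    then show ?thesis using post_subset_states[OF ngba] by (simp add: spawn_label_old)
  next
    case False
    then obtain u where u: "v = u @ [card (children T u)]" "u \<in> T"
      using \<open>v \<in> S\<close> by (auto simp: spawn_tree_def)
    then have "sl v \<subseteq> sl u" using spawn_label_child \<open>v \<in> S\<close> by blast
    then show ?thesis
      using u post_subset_states[OF ngba] by (auto simp: spawn_label_old)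
  qed
  then show ?thesis using stolen_subset by blast
qed

text \<open>Each condition is pulled back to \<open>P\<close> along the injective renaming.
  Strictness for a single child follows from strictness for the union of all children.\<close>

lemma ght_renamed: "is_ght B d'"
proof -
  have "ordered_tree (tree d')"
    unfolding tree_renamed using finite_pruned root_pruned pruned_closed
    by (intro ordered_tree_rename) auto
  moreover have "label d' \<in> tree d' \<rightarrow>\<^sub>E (Pow (states B) - {{}})"
  proof (rule PiE_I)
    fix x assume "x \<in> tree d'"
    then obtain v where v: "v \<in> P" "x = rename P v" by (auto simp: tree_renamed)
    then show "label d' x \<in> Pow (states B) - {{}}"
      using stolen_states[of v] pruned_subset pruned_nonempty[of v] by (auto simp: label_renamed)
  qed (simp add: renamed_ght_def Let_def)
  moreover have "index d' \<in> tree d' \<rightarrow>\<^sub>E {1..acc_count B}"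
  proof (rule PiE_I)
    fix x assume "x \<in> tree d'"
    then obtain v where "v \<in> P" "x = rename P v" by (auto simp: tree_renamed)
    then show "index d' x \<in> {1..acc_count B}"
      using accepting_index_in[of v] by (simp add: index_renamed)
  qed (simp add: renamed_ght_def Let_def)
  moreover have children: "(\<Union>u\<in>children (tree d') x. label d' u) \<subset> label d' x"
    if "x \<in> tree d'" for x
  proof -
    from that obtain v where v: "v \<in> P" "x = rename P v" by (auto simp: tree_renamed)
    then show ?thesis
      using stolen_children_pruned_psubset by (simp add: label_children_renamed label_renamed)
  qed
  moreover have "label d' (x @ [n]) \<subset> label d' x" if "x @ [n] \<in> tree d'" for x n
  proof -
    have "x \<in> tree d'" using that \<open>ordered_tree (tree d')\<close> by (auto simp: ordered_tree_def)
    then show ?thesis using children[of x] that by (auto simp: children_def)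
  qed
  moreover have "label d' (x @ [m]) \<inter> label d' (x @ [n]) = {}"
    if "x @ [m] \<in> tree d'" "x @ [n] \<in> tree d'" "m \<noteq> n" for x m n
  proof -
    from that(1)[unfolded tree_renamed]
    obtain u a where u: "u @ [a] \<in> P" "rename P u = x" "rename P (u @ [a]) = x @ [m]"
      by (rule rename_image_snocE)
    from that(2)[unfolded tree_renamed]
    obtain v b where v: "v @ [b] \<in> P" "rename P v = x" "rename P (v @ [b]) = x @ [n]"
      by (rule rename_image_snocE)
    \<comment> \<open>Both siblings have preimages below parents with the same image
      \<open>x\<close>, so injectivity makes the preimages siblings again.\<close>
    have "u = v"
      by (rule inj_onD[OF inj_rename]) (use u v pruned_closed in auto)
    moreover have "a \<noteq> b" using u v that(3) \<open>u = v\<close> by auto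
    ultimately have "st (u @ [a]) \<inter> st (v @ [b]) = {}"
      using u v pruned_subset stolen_disjoint by blast
    then show ?thesis using label_renamed u v by metis
  qed
  ultimately show ?thesis by (auto simp: is_ght_def)
qed

text \<open>The root survives under its own name. If it accepts, its children vanish, matching the
  reset to \<open>{}\<close>; otherwise the union of their labels is \<open>bp_next\<close>.\<close>

lemma bp_succ_bp_of: "bp_succ B (bp_of d) \<sigma> = Some (bp_of d')"
proof -
  let ?R = "post (trans B) (label d []) \<sigma>" and ?C = "bp_next B (bp_of d) \<sigma>"
  have lab: "label d' [] = ?R"
    using label_renamed[OF root_pruned] by (simp add: stolen_root)
  have idx: "index d' [] = (if ?C = ?R then cyc_succ (acc_count B) (index d []) else index d [])"
    using index_renamed[OF root_pruned] root_accepting_iff ght_root[OF ght]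
    by (simp add: accepting_index_def spawn_index_def)
  have ch: "(\<Union>u\<in>children (tree d') []. label d' u) = (\<Union>u\<in>children P []. st u)"
    using label_children_renamed[OF root_pruned] by simp
  have "(\<Union>u\<in>children P []. st u) = (if ?C = ?R then {} else ?C)"
  proof (cases "?C = ?R")
    case True
    then show ?thesis using root_accepting_iff accepting_children_pruned by auto
  next
    case False
    \<comment> \<open>The only proper ancestor of these nodes is the root, which does not accept; so
      only empty labels are removed, and these do not affect the union.\<close>
    then have "children P [] = {u \<in> children S []. st u \<noteq> {}}"
      using root_accepting_iff
      by (auto simp: children_def pruned_tree_def Cons_eq_append_conv)
    then have "(\<Union>u\<in>children P []. st u) = (\<Union>u\<in>children S []. st u)" by auto
    then show ?thesis using False stolen_children_root by simp
  qed
  then have "bp_of d' = (?R, if ?C = ?R then cyc_succ (acc_count B) (index d []) else index d [],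
      if ?C = ?R then {} else ?C)"
    unfolding bp_of_def lab idx ch by simp
  then show ?thesis
    using enabled by (simp add: bp_succ_def rchd_def bp_of_def Let_def)
qed

lemma rchd_renamed: "rchd d' = post (trans B) (rchd d) \<sigma>"
  using label_renamed[OF root_pruned] by (simp add: stolen_root rchd_def)

section \<open>Nodes that survive a transition under the same name\<close>

lemma stable_index:
  assumes "v \<in> T" "v \<in> P" "rename P v = v"
  shows "index d' v = (if v \<in> accepting_nodes B d \<sigma>
    then cyc_succ (acc_count B) (index d v) else index d v)"
  using index_renamed[OF assms(2)] assms by (simp add: accepting_index_def spawn_index_def)

lemma stable_accepting_children:
  assumes "v \<in> P" "rename P v = v" "v \<in> accepting_nodes B d \<sigma>"
  shows "children (tree d') v = {}"
  using children_renamed[OF assms(1)] assms by (simp add: accepting_children_pruned)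

text \<open>The only child of \<open>v\<close> after spawning is the new one, and its label is
  empty. Acceptance would then force the label of \<open>v\<close> to be empty, contradicting
  \<open>v \<in> P\<close>.\<close>

lemma stable_childless:
  assumes v: "v \<in> T" "v \<in> P" "rename P v = v"
    and "children T v = {}" "post (acc_sets B (index d v)) (label d v) \<sigma> = {}"
  shows "v \<notin> accepting_nodes B d \<sigma>" and "children (tree d') v = {}"
proof -
  have "sl (v @ [card (children T v)]) = {}"
    using assms(5) by (simp only: spawn_label_new)
  then have empty: "st u = {}" if "u \<in> children S v" for u
    using that stolen_subset[of u] assms(4) children_spawn[OF v(1)] by auto
  then show "v \<notin> accepting_nodes B d \<sigma>"
    using pruned_nonempty[OF v(2)] by (auto simp: accepting_nodes_def)
  have "children P v = {}"
    using empty by (auto simp: children_def pruned_tree_def)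
  then show "children (tree d') v = {}"
    using children_renamed[OF v(2)] v(3) by simp
qed

text \<open>The first entry of \<open>v\<close> names a child of the root that is a prefix of
  \<open>v\<close>, hence lies in both trees; its label after stealing is nonempty, so its
  \<open>trans B\<close> successors are too.\<close>

lemma stable_nonroot:
  assumes "v \<noteq> []" "v \<in> T" "v \<in> P"
  shows "post (trans B) (\<Union>u\<in>children T []. label d u) \<sigma> \<noteq> {}"
proof -
  obtain c w where v: "v = [c] @ w" using assms(1) by (cases v) auto
  have c: "[c] \<in> T" "[c] \<in> P"
    using assms(2,3) ordered_tree_prefix[OF ordered] pruned_prefix v by blast+
  then have "post (trans B) (label d [c]) \<sigma> \<noteq> {}"
    using stolen_subset[of "[c]"] pruned_nonempty[of "[c]"] by (simp add: spawn_label_old) blast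
  moreover have "[c] \<in> children T []" using c by (simp add: children_def)
  ultimately show ?thesis by (auto simp: post_UN)
qed

end

section \<open>Runs\<close>

lemma lang_start_at:
  "w \<in> lang (start_at X x) \<longleftrightarrow> (\<exists>r. r 0 = x \<and>
     (\<forall>n. (r n, w n, r (Suc n)) \<in> transitions_of (da_states X) (da_alphabet X) (da_succ X)) \<and>
     accepting (da_acceptance X) (\<lambda>n. (r n, w n, r (Suc n))))"
  by (auto simp: lang_def da_run_def start_at_def)

lemma ght_step_of_det_transition:
  assumes "is_ngba B" "(d, \<sigma>, d') \<in> det_transitions B"
  shows "ght_step B d \<sigma>" "\<sigma> \<in> alphabet B" "d' = renamed_ght B d \<sigma>"
  using assms
  by (auto simp: ght_step_def det_transitions_def transitions_of_def det_states_def det_succ_def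
      split: if_splits)

lemma bp_of_in: "is_ngba B \<Longrightarrow> is_ght B d \<Longrightarrow> bp_of d \<in> bp_states B"
  using ght_root[of B d] by (fastforce simp: bp_of_def bp_states_def is_ght_def PiE_iff)

lemma rchd_subset: "is_ght B d \<Longrightarrow> rchd d \<subseteq> states B"
  using ght_root[of B d] by (auto simp: rchd_def is_ght_def PiE_iff)

lemma fst_bp_of: "fst (bp_of d) = label d []"
  by (simp add: bp_of_def)

lemma bp_A_iff: "(s, \<sigma>, s') \<in> bp_A B \<longleftrightarrow>
    (s, \<sigma>, s') \<in> bp_transitions B \<and> bp_next B s \<sigma> = post (trans B) (fst s) \<sigma>"
  by (cases s; cases s') (simp add: bp_A_def)

lemma bp_R_iff: "(s, \<sigma>, s') \<in> bp_R B \<longleftrightarrow>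
    (s, \<sigma>, s') \<in> bp_transitions B \<and> bp_next B s \<sigma> \<noteq> post (trans B) (fst s) \<sigma> \<and>
    post (trans B) (snd (snd s)) \<sigma> = {}"
  by (cases s; cases s') (simp add: bp_R_def)

lemma accepting_det: "accepting (da_acceptance (det B)) \<tau> \<longleftrightarrow>
    (\<exists>v. (\<exists>T. ordered_tree T \<and> card T = card (states B) \<and> v \<in> T) \<and>
      infinite {n. \<tau> n \<in> det_A B v} \<and> finite {n. \<tau> n \<in> det_R B v})"
  by (simp add: det_def) blast

text \<open>A single path of \<open>n\<close> nodes suffices. This makes the root one of the nodes
  that index the Rabin pairs of \<open>det B\<close>.\<close>

lemma ex_ordered_tree_card: "n \<ge> 1 \<Longrightarrow> \<exists>T. ordered_tree T \<and> card T = n \<and> [] \<in> T"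
proof -
  assume "n \<ge> 1"
  let ?T = "(\<lambda>i. replicate i (0::nat)) ` {..<n}"
  have "v \<in> ?T \<and> (\<forall>i<m. v @ [i] \<in> ?T)" if "v @ [m] \<in> ?T" for v m
  proof -
    from that obtain j where j: "j < n" "v @ [m] = replicate j 0" by auto
    then obtain i where i: "j = Suc i" by (cases j) auto
    then have "v @ [m] = replicate i 0 @ [0]" using j by (simp add: replicate_append_same)
    then show ?thesis using i j by auto
  qed
  moreover have Nil: "[] \<in> ?T" using \<open>n \<ge> 1\<close> by (force simp: image_iff)
  ultimately have "ordered_tree ?T" unfolding ordered_tree_def by blast
  moreover have "card ?T = n" by (subst card_image) (auto simp: inj_on_def)
  ultimately show ?thesis using Nil by blast
qed

text \<open>\<open>h\<close> changes only where \<open>acc\<close> holds, and then by one step of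
  the cycle. It first climbs to \<open>k\<close>; the next acceptance wraps it to 1, and further
  ones climb to \<open>i\<close>.\<close>

lemma cyc_succ_visits:
  fixes h :: "nat \<Rightarrow> nat" and acc :: "nat \<Rightarrow> bool"
  assumes step: "\<And>n. n \<ge> N \<Longrightarrow> h (Suc n) = (if acc n then cyc_succ k (h n) else h n)"
    and inf: "\<And>m. \<exists>n\<ge>m. acc n"
    and range: "h N \<in> {1..k}" and i: "i \<in> {1..k}"
  shows "\<exists>n\<ge>N. acc n \<and> h (Suc n) = i"
proof -
  have range': "h n \<in> {1..k}" if "n \<ge> N" for n
    using that range i
    by (induction n rule: dec_induct) (auto simp: step cyc_succ_def)
  have succ: "\<exists>m\<ge>n. acc m \<and> h (Suc m) = cyc_succ k (h n)" if n: "n \<ge> N" for n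
  proof -
    \<comment> \<open>The first acceptance from \<open>n\<close> on; \<open>h\<close> keeps the
      value \<open>h n\<close> until then.\<close>
    define m where "m = (LEAST m. m \<ge> n \<and> acc m)"
    have m: "m \<ge> n \<and> acc m" unfolding m_def by (rule LeastI_ex) (use inf in blast)
    have no_acc: "\<not> acc x" if "n \<le> x" "x < m" for x
      using not_less_Least[of x "\<lambda>m. m \<ge> n \<and> acc m"] that m_def by blast
    have "h x = h n" if "n \<le> x" "x \<le> m" for x
      using that by (induction x rule: dec_induct) (use step n no_acc in auto)
    from this[of m] have "h (Suc m) = cyc_succ k (h n)" using m step[of m] n by simp
    then show ?thesis using m by blast
  qed
  \<comment> \<open>Induction on the remaining distance \<open>j\<close> to the top of the
    cycle.\<close>
  have top: "\<exists>m\<ge>N. h m = k" if "n \<ge> N" "h n = k - j" for n j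
    using that
  proof (induction j arbitrary: n)
    case 0
    then show ?case by auto
  next
    case (Suc j)
    show ?case
    proof (cases "h n < k")
      case True
      obtain m where m: "m \<ge> n" "h (Suc m) = cyc_succ k (h n)" using succ Suc.prems(1) by blast
      have "k > j" using Suc.prems(2) range'[OF Suc.prems(1)] by auto
      then have "h (Suc m) = k - j"
        using m True Suc.prems(2) by (simp add: cyc_succ_def)
      then show ?thesis using Suc.IH[of "Suc m"] m Suc.prems(1) by simp
    next
      case False
      then show ?thesis using range'[OF Suc.prems(1)] Suc.prems(1) by force
    qed
  qed
  have "\<exists>m\<ge>N. h m = k" using top[of N "k - h N"] range by auto
  then obtain m where m: "m \<ge> N" "h m = k" by blast
  have "Suc j \<le> k \<Longrightarrow> \<exists>n\<ge>N. acc n \<and> h (Suc n) = Suc j" for j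
  proof (induction j)
    case 0
    obtain n where "n \<ge> m" "acc n" "h (Suc n) = cyc_succ k k" using succ[OF m(1)] m(2) by auto
    then show ?case using m(1) by (intro exI[of _ n]) (simp add: cyc_succ_def)
  next
    case (Suc j)
    then obtain n where n: "n \<ge> N" "h (Suc n) = Suc j" by auto
    then obtain l where "l \<ge> Suc n" "acc l" "h (Suc l) = cyc_succ k (Suc j)"
      using succ[of "Suc n"] by auto
    then show ?case using n Suc.prems by (intro exI[of _ l]) (simp add: cyc_succ_def)
  qed
  from this[of "i - 1"] show ?thesis using i by simp
qed

section \<open>The language inclusions\<close>

lemma subset_u_subset_breakpoint_u:
  assumes B: "is_ngba B" and d: "is_ght B d"
  shows "lang (start_at (subset_u B) (rchd d)) \<subseteq> lang (start_at (breakpoint_u B) (bp_of d))"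
proof
  fix w assume "w \<in> lang (start_at (subset_u B) (rchd d))"
  then obtain R where R0: "R 0 = rchd d"
    and R: "\<And>n. (R n, w n, R (Suc n)) \<in> transitions_of (Pow (states B)) (alphabet B) (subset_succ B)"
    and acc: "\<And>i. i \<in> {1..acc_count B} \<Longrightarrow> infinite {n. (R n, w n, R (Suc n)) \<in> subset_Fu B i}"
    unfolding lang_start_at by (auto simp: subset_u_def)
  have RS: "w n \<in> alphabet B" "R n \<noteq> {}" "R n \<subseteq> states B" "R (Suc n) = post (trans B) (R n) (w n)"
    for n
    using R[of n] by (auto simp: transitions_of_def subset_succ_def split: if_splits)
  \<comment> \<open>The breakpoint run is built by recursion; \<open>tr\<close> below confirms that
    \<open>the\<close> is only applied to defined successors.\<close>
  define s where "s = rec_nat (bp_of d) (\<lambda>n x. the (bp_succ B x (w n)))"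
  have s0: "s 0 = bp_of d" and sS: "s (Suc n) = the (bp_succ B (s n) (w n))" for n
    by (simp_all add: s_def)
  have k: "1 \<le> acc_count B" using B by (simp add: is_ngba_def)
  have C_sub: "bp_next B (X, j, C) (w n) \<subseteq> post (trans B) X (w n)"
    if "C \<subset> X" "j \<in> {1..acc_count B}" for X j C n
  proof -
    have "acc_sets B j \<subseteq> trans B" using B that(2) by (simp add: is_ngba_def)
    then show ?thesis using that(1) by (simp add: bp_next_def post_mono psubset_imp_subset)
  qed
  \<comment> \<open>\<open>R (Suc n)\<close> is the source of the next subset transition, hence
    nonempty, so the breakpoint automaton is never blocked.\<close>
  have succ: "bp_succ B (R n, j, C) (w n) =
      Some (if bp_next B (R n, j, C) (w n) = R (Suc n)
        then (R (Suc n), cyc_succ (acc_count B) j, {})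
        else (R (Suc n), j, bp_next B (R n, j, C) (w n)))" for n j C
    using RS(2)[of "Suc n"] unfolding RS(4)[of n] by (simp add: bp_succ_def Let_def)
  have inv: "s n \<in> bp_states B \<and> fst (s n) = R n" for n
  proof (induction n)
    case 0
    show ?case using bp_of_in[OF B d] R0 by (simp add: s0) (simp add: bp_of_def rchd_def)
  next
    case (Suc n)
    obtain j C where s: "s n = (R n, j, C)" "C \<subset> R n" "j \<in> {1..acc_count B}"
      using Suc.IH by (cases "s n") (auto simp: bp_states_def)
    then show ?case
      using C_sub[OF s(2,3), of n, folded RS(4)[of n]] RS(2,3)[of "Suc n"] cyc_succ_in[OF k s(3)]
      by (auto simp: sS succ bp_states_def)
  qed
  have s_form: "\<exists>j C. s n = (R n, j, C) \<and> C \<subset> R n \<and> j \<in> {1..acc_count B}" for n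
    using inv[of n] by (cases "s n") (auto simp: bp_states_def)
  have tr: "(s n, w n, s (Suc n)) \<in> bp_transitions B" for n
  proof -
    have "bp_succ B (s n) (w n) \<noteq> None"
      using s_form[of n] succ by auto
    then show ?thesis
      using inv[of n] RS(1)[of n] by (auto simp: bp_transitions_def transitions_of_def sS)
  qed
  \<comment> \<open>With finitely many breakpoints the index would be constant from some
    \<open>N\<close> on, say \<open>j\<close>; but a later transition in
    \<open>subset_Fu B j\<close> forces a breakpoint.\<close>
  have "infinite {n. (s n, w n, s (Suc n)) \<in> bp_A B}"
  proof
    assume "finite {n. (s n, w n, s (Suc n)) \<in> bp_A B}"
    then obtain N where N: "\<And>n. n \<ge> N \<Longrightarrow> (s n, w n, s (Suc n)) \<notin> bp_A B"
      by (metis (mono_tags, lifting) finite_nat_set_iff_bounded mem_Collect_eq not_le)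
    define j where "j = fst (snd (s N))"
    have no_breakpoint: "bp_next B (s n) (w n) \<noteq> R (Suc n)" if "n \<ge> N" for n
      using N[OF that] tr[of n] inv[of n] RS(4)[of n] by (simp add: bp_A_iff)
    have const: "fst (snd (s n)) = j" if "n \<ge> N" for n
      using that
    proof (induction n rule: dec_induct)
      case base
      then show ?case by (simp add: j_def)
    next
      case (step n)
      then obtain C where "s n = (R n, j, C)" using s_form[of n] by auto
      then show ?case using no_breakpoint[OF step(1)] by (simp add: sS succ)
    qed
    have "j \<in> {1..acc_count B}" using s_form[of N] by (auto simp: j_def)
    from acc[OF this] obtain n where n: "n \<ge> N" "(R n, w n, R (Suc n)) \<in> subset_Fu B j"
      by (metis (mono_tags, lifting) infinite_nat_iff_unbounded_le mem_Collect_eq)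
    obtain C where s: "s n = (R n, j, C)" "C \<subset> R n" "j \<in> {1..acc_count B}"
      using s_form[of n] const[OF n(1)] by (metis fst_conv snd_conv)
    \<comment> \<open>Any element of the nonempty set \<open>R n\<close> serves as predecessor for
      every state of \<open>R (Suc n)\<close>.\<close>
    have "R (Suc n) \<subseteq> post (acc_sets B j) (R n) (w n)"
      using n(2) RS(2)[of n] by (fastforce simp: subset_Fu_def post_def)
    then have "bp_next B (s n) (w n) = R (Suc n)"
      using C_sub[OF s(2,3), of n] RS(4)[of n] s(1) by (auto simp: bp_next_def)
    then show False using no_breakpoint n(1) by blast
  qed
  then show "w \<in> lang (start_at (breakpoint_u B) (bp_of d))"
    unfolding lang_start_at using s0 tr
    by (intro exI[of _ s]) (auto simp: breakpoint_u_def bp_transitions_def)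
qed

lemma breakpoint_u_subset_det:
  assumes B: "is_ngba B" and d: "is_ght B d"
  shows "lang (start_at (breakpoint_u B) (bp_of d)) \<subseteq> lang (start_at (det B) d)"
proof
  fix w assume "w \<in> lang (start_at (breakpoint_u B) (bp_of d))"
  then obtain s where s0: "s 0 = bp_of d"
    and s: "\<And>n. (s n, w n, s (Suc n)) \<in> transitions_of (bp_states B) (alphabet B) (bp_succ B)"
    and acc: "infinite {n. (s n, w n, s (Suc n)) \<in> bp_A B}"
    unfolding lang_start_at by (auto simp: breakpoint_u_def)
  \<comment> \<open>The tree run applies the update unconditionally; that it is enabled follows from
    the breakpoint run, to which \<open>bp_of\<close> maps it.\<close>
  define r where "r = rec_nat d (\<lambda>n x. renamed_ght B x (w n))"
  have r0: "r 0 = d" and rS: "r (Suc n) = renamed_ght B (r n) (w n)" for n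
    by (simp_all add: r_def)
  have sn: "w n \<in> alphabet B" "bp_succ B (s n) (w n) = Some (s (Suc n))" for n
    using s[of n] by (auto simp: transitions_of_def)
  have step: "ght_step B (r n) (w n)" if "is_ght B (r n)" "bp_of (r n) = s n" for n
  proof -
    have "bp_succ B (bp_of (r n)) (w n) \<noteq> None" using sn(2)[of n] that(2) by simp
    then have "post (trans B) (rchd (r n)) (w n) \<noteq> {}"
      by (auto simp: bp_of_def bp_succ_def rchd_def)
    then show ?thesis using B that(1) by (simp add: ght_step_def)
  qed
  have inv: "is_ght B (r n) \<and> bp_of (r n) = s n" for n
  proof (induction n)
    case 0
    show ?case using d s0 r0 by simp
  next
    case (Suc n)
    then interpret ght_step B "r n" "w n" using step by blast
    show ?case using ght_renamed bp_succ_bp_of sn(2)[of n] Suc.IH by (simp add: rS)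
  qed
  have tr: "(r n, w n, r (Suc n)) \<in> det_transitions B" for n
  proof -
    interpret ght_step B "r n" "w n" using step inv by blast
    show ?thesis
      using enabled sn(1)[of n] ght
      by (simp add: det_transitions_def transitions_of_def det_states_def det_succ_def rS)
  qed
  have "(r n, w n, r (Suc n)) \<in> det_A B []" if "(s n, w n, s (Suc n)) \<in> bp_A B" for n
  proof -
    interpret ght_step B "r n" "w n" using step inv by blast
    have "bp_next B (bp_of (r n)) (w n) = post (trans B) (label (r n) []) (w n)"
      using that inv[of n] by (metis bp_A_iff fst_bp_of)
    then show ?thesis using tr[of n] root_accepting_iff by (simp add: det_A_def)
  qed
  then have "infinite {n. (r n, w n, r (Suc n)) \<in> det_A B []}"
    using acc by (meson Collect_mono infinite_super)
  \<comment> \<open>The root survives every enabled transition, and \<open>rename\<close> fixes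
    it.\<close>
  moreover have "(r n, w n, r (Suc n)) \<notin> det_R B []" for n
  proof -
    interpret ght_step B "r n" "w n" using step inv by blast
    show ?thesis using root_pruned ght_root[OF ght] by (simp add: det_R_def)
  qed
  then have "finite {n. (r n, w n, r (Suc n)) \<in> det_R B []}" by simp
  moreover have "\<exists>T. ordered_tree T \<and> card T = card (states B) \<and> [] \<in> T"
  proof (rule ex_ordered_tree_card)
    have "finite (states B)" "states B \<noteq> {}" using B by (auto simp: is_ngba_def)
    then show "1 \<le> card (states B)" by (simp add: Suc_le_eq card_gt_0_iff)
  qed
  ultimately have "accepting (da_acceptance (det B)) (\<lambda>n. (r n, w n, r (Suc n)))"
    unfolding accepting_det by blast
  then show "w \<in> lang (start_at (det B) d)"
    unfolding lang_start_at using r0 tr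
    by (intro exI[of _ r]) (auto simp: det_def det_transitions_def)
qed

text \<open>Shared start of the two inclusions out of \<open>det B\<close>: the node
  \<open>v\<close> of an accepting Rabin pair accepts infinitely often and keeps its name from
  \<open>N\<close> on.\<close>

lemma lang_detE:
  assumes B: "is_ngba B" and w: "w \<in> lang (start_at (det B) d)"
  obtains r v N where "r 0 = d" "\<And>n. ght_step B (r n) (w n)" "\<And>n. w n \<in> alphabet B"
    "\<And>n. r (Suc n) = renamed_ght B (r n) (w n)"
    "\<And>m. \<exists>n\<ge>m. v \<in> accepting_nodes B (r n) (w n)"
    "\<And>n. n \<ge> N \<Longrightarrow> v \<in> tree (r n) \<and> v \<in> pruned_tree B (r n) (w n) \<and>
       rename (pruned_tree B (r n) (w n)) v = v"
proof -
  obtain r v where r0: "r 0 = d"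
    and tr: "\<And>n. (r n, w n, r (Suc n)) \<in> det_transitions B"
    and A: "infinite {n. (r n, w n, r (Suc n)) \<in> det_A B v}"
    and R: "finite {n. (r n, w n, r (Suc n)) \<in> det_R B v}"
    using w unfolding lang_start_at accepting_det by (auto simp: det_def det_transitions_def)
  obtain N where N: "\<And>n. n \<ge> N \<Longrightarrow> (r n, w n, r (Suc n)) \<notin> det_R B v"
    using R by (metis (mono_tags, lifting) finite_nat_set_iff_bounded mem_Collect_eq not_le)
  show thesis
  proof (rule that[of r v N])
    fix n
    show "ght_step B (r n) (w n)" "w n \<in> alphabet B" "r (Suc n) = renamed_ght B (r n) (w n)"
      using ght_step_of_det_transition[OF B tr] by blast+
  next
    fix m
    obtain n where "n \<ge> m" "(r n, w n, r (Suc n)) \<in> det_A B v"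
      using A by (metis (mono_tags, lifting) infinite_nat_iff_unbounded_le mem_Collect_eq)
    then show "\<exists>n\<ge>m. v \<in> accepting_nodes B (r n) (w n)" by (auto simp: det_A_def)
  next
    fix n assume "n \<ge> N"
    then show "v \<in> tree (r n) \<and> v \<in> pruned_tree B (r n) (w n) \<and>
       rename (pruned_tree B (r n) (w n)) v = v"
      using N[of n] tr[of n] by (auto simp: det_R_def)
  qed (rule r0)
qed

lemma det_subset_breakpoint_o:
  assumes B: "is_ngba B"
  shows "lang (start_at (det B) d) \<subseteq> lang (start_at (breakpoint_o B) (bp_of d))"
proof
  fix w assume "w \<in> lang (start_at (det B) d)"
  then obtain r v N where r0: "r 0 = d" and step: "\<And>n. ght_step B (r n) (w n)"
    and w: "\<And>n. w n \<in> alphabet B"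
    and rS: "\<And>n. r (Suc n) = renamed_ght B (r n) (w n)"
    and acc: "\<And>m. \<exists>n\<ge>m. v \<in> accepting_nodes B (r n) (w n)"
    and stable: "\<And>n. n \<ge> N \<Longrightarrow> v \<in> tree (r n) \<and> v \<in> pruned_tree B (r n) (w n) \<and>
       rename (pruned_tree B (r n) (w n)) v = v"
    using lang_detE[OF B] by metis
  define s where "s n = bp_of (r n)" for n
  have tr: "(s n, w n, s (Suc n)) \<in> bp_transitions B" for n
  proof -
    interpret ght_step B "r n" "w n" by (rule step)
    show ?thesis
      using bp_succ_bp_of bp_of_in[OF B ght] w[of n]
      by (simp add: s_def rS bp_transitions_def transitions_of_def)
  qed
  \<comment> \<open>The root satisfies the first Rabin pair, any other stable node the second; every
    transition lies in the accepting part of the second pair.\<close>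
  have "infinite {n. (s n, w n, s (Suc n)) \<in> bp_A B} \<or>
      finite {n. (s n, w n, s (Suc n)) \<in> bp_R B}"
  proof (cases "v = []")
    case True
    have "(s n, w n, s (Suc n)) \<in> bp_A B" if "v \<in> accepting_nodes B (r n) (w n)" for n
    proof -
      interpret ght_step B "r n" "w n" by (rule step)
      show ?thesis
        using root_accepting_iff that True tr[of n] by (simp add: bp_A_iff s_def fst_bp_of)
    qed
    then have "\<exists>n\<ge>m. (s n, w n, s (Suc n)) \<in> bp_A B" for m
      using acc by blast
    then show ?thesis by (simp add: infinite_nat_iff_unbounded_le)
  next
    case False
    have "(s n, w n, s (Suc n)) \<notin> bp_R B" if "n \<ge> N" for n
    proof -
      interpret ght_step B "r n" "w n" by (rule step)
      show ?thesis
        using stable_nonroot[OF False] stable[OF that] by (auto simp: bp_R_iff s_def bp_of_def)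
    qed
    then have "{n. (s n, w n, s (Suc n)) \<in> bp_R B} \<subseteq> {..<N}"
      by (auto simp: not_le[symmetric])
    then show ?thesis using finite_subset by blast
  qed
  then show "w \<in> lang (start_at (breakpoint_o B) (bp_of d))"
    unfolding lang_start_at using r0 tr
    by (intro exI[of _ s]) (auto simp: s_def breakpoint_o_def bp_transitions_def)
qed

lemma det_subset_subset_o:
  assumes B: "is_ngba B"
  shows "lang (start_at (det B) d) \<subseteq> lang (start_at (subset_o B) (rchd d))"
proof
  fix w assume "w \<in> lang (start_at (det B) d)"
  then obtain r v N where r0: "r 0 = d" and step: "\<And>n. ght_step B (r n) (w n)"
    and w: "\<And>n. w n \<in> alphabet B"
    and rS: "\<And>n. r (Suc n) = renamed_ght B (r n) (w n)"
    and acc: "\<And>m. \<exists>n\<ge>m. v \<in> accepting_nodes B (r n) (w n)"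
    and stable: "\<And>n. n \<ge> N \<Longrightarrow> v \<in> tree (r n) \<and> v \<in> pruned_tree B (r n) (w n) \<and>
       rename (pruned_tree B (r n) (w n)) v = v"
    using lang_detE[OF B] by metis
  define R where "R n = rchd (r n)" for n
  have RS: "R (Suc n) = post (trans B) (R n) (w n)" for n
  proof -
    interpret ght_step B "r n" "w n" by (rule step)
    show ?thesis using rchd_renamed by (simp add: R_def rS)
  qed
  have tr: "(R n, w n, R (Suc n)) \<in> subset_transitions B" for n
  proof -
    interpret ght_step B "r n" "w n" by (rule step)
    have "R n \<noteq> {}" using enabled by (auto simp: R_def)
    then show ?thesis
      using rchd_subset[OF ght] w[of n]
      by (simp add: subset_transitions_def transitions_of_def subset_succ_def RS)
        (simp add: R_def)
  qed
  have Fo: "infinite {n. (R n, w n, R (Suc n)) \<in> subset_Fo B i}" if i: "i \<in> {1..acc_count B}" for i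
  proof
    assume "finite {n. (R n, w n, R (Suc n)) \<in> subset_Fo B i}"
    then obtain M where M: "\<And>n. n \<ge> M \<Longrightarrow> (R n, w n, R (Suc n)) \<notin> subset_Fo B i"
      by (metis (mono_tags, lifting) finite_nat_set_iff_bounded mem_Collect_eq not_le)
    let ?N = "max N M"
    \<comment> \<open>The label of \<open>v\<close> lies in \<open>R n\<close>, so a successor along
      \<open>acc_sets B i\<close> would put the transition into
      \<open>subset_Fo B i\<close>.\<close>
    have no_post: "post (acc_sets B i) (label (r n) v) (w n) = {}" if n: "n \<ge> ?N" for n
    proof -
      interpret ght_step B "r n" "w n" by (rule step)
      have "label (r n) v \<subseteq> R n"
        using ght_label_prefix[OF ght, of "[]" v] stable[of n] n by (simp add: R_def rchd_def)
      moreover have "acc_sets B i \<subseteq> trans B" using B i by (simp add: is_ngba_def)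
      ultimately show ?thesis
        using M[of n] n tr[of n] by (fastforce simp: subset_Fo_def RS post_def)
    qed
    have "\<exists>n\<ge>?N. v \<in> accepting_nodes B (r n) (w n) \<and> index (r (Suc n)) v = i"
    proof (rule cyc_succ_visits[where k = "acc_count B" and h = "\<lambda>n. index (r n) v"])
      fix n assume n: "n \<ge> ?N"
      interpret ght_step B "r n" "w n" by (rule step)
      show "index (r (Suc n)) v = (if v \<in> accepting_nodes B (r n) (w n)
          then cyc_succ (acc_count B) (index (r n) v) else index (r n) v)"
        using stable_index stable[of n] n by (simp add: rS)
    next
      interpret ght_step B "r ?N" "w ?N" by (rule step)
      show "index (r ?N) v \<in> {1..acc_count B}" using index_in stable[of ?N] by simp
    qed (use acc i in auto)
    then obtain n where n: "n \<ge> ?N" "v \<in> accepting_nodes B (r n) (w n)" "index (r (Suc n)) v = i"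
      by blast
    \<comment> \<open>The acceptance at \<open>n\<close> leaves \<open>v\<close> childless with
      index \<open>i\<close>. By \<open>no_post\<close> every later spawned child is empty, so
      \<open>v\<close> never accepts again and its index stays \<open>i\<close>.\<close>
    have "index (r m) v = i \<and> children (tree (r m)) v = {}" if "m \<ge> Suc n" for m
      using that
    proof (induction m rule: dec_induct)
      case base
      interpret ght_step B "r n" "w n" by (rule step)
      show ?case using n stable[of n] stable_accepting_children by (simp add: rS)
    next
      case (step m)
      interpret ght_step B "r m" "w m" by (rule \<open>\<And>n. ght_step B (r n) (w n)\<close>)
      show ?case
        using step n stable[of m] stable_childless[of v] stable_index[of v] no_post[of m]
        by (simp add: rS)
    qed
    then have "v \<notin> accepting_nodes B (r m) (w m)" if "m \<ge> Suc n" for m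
    proof -
      interpret ght_step B "r m" "w m" by (rule step)
      show ?thesis
        using that n stable[of m] stable_childless(1)[of v] no_post[of m]
          \<open>\<And>m. m \<ge> Suc n \<Longrightarrow> index (r m) v = i \<and> children (tree (r m)) v = {}\<close>
        by simp
    qed
    then show False using acc[of "Suc n"] by blast
  qed
  have "accepting (da_acceptance (subset_o B)) (\<lambda>n. (R n, w n, R (Suc n)))"
    using Fo by (simp add: subset_o_def)
  then show "w \<in> lang (start_at (subset_o B) (rchd d))"
    unfolding lang_start_at using r0 tr
    by (intro exI[of _ R]) (simp add: R_def subset_o_def subset_transitions_def)
qed

theorem theorem21:
  fixes B :: "('q, 'a) ngba" and d :: "'q ght"
  assumes "is_ngba B"
    and "d \<in> da_states (det B)"
  shows "lang (start_at (subset_u B) (rchd d)) \<subseteq> lang (start_at (breakpoint_u B) (bp_of d))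
       \<and> lang (start_at (breakpoint_u B) (bp_of d)) \<subseteq> lang (start_at (det B) d)
       \<and> lang (start_at (det B) d) \<subseteq> lang (start_at (breakpoint_o B) (bp_of d))
       \<and> lang (start_at (det B) d) \<subseteq> lang (start_at (subset_o B) (rchd d))"
proof -
  have "is_ght B d" using assms(2) by (simp add: det_def det_states_def)
  then show ?thesis
    using assms(1) subset_u_subset_breakpoint_u breakpoint_u_subset_det det_subset_breakpoint_o
      det_subset_subset_o by blast
qed

end
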